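(* Let $0\le|\beta|<\alpha$, $\mu\in\mathbb{R}\setminus\{0\}$ and let $X\sim\mathrm{AL}(\alpha,\beta,\mu)$. Then, for every real $r>-1$, $$\mathbb{E}[|X|^r]=\frac{\alpha^2-\beta^2}{2\alpha^{r+2}}\bigg[\frac{\mathrm{e}^{-\alpha|\mu|-\beta\mu}\,\Gamma(r+1)}{(1+\mathrm{sgn}(\mu)\beta/\alpha)^{r+1}}+\frac{(\alpha|\mu|)^{r+1}}{r+1}M(1,r+2,-\alpha|\mu|-\beta\mu)+(\alpha|\mu|)^{r+1}U(1,r+2,\alpha|\mu|-\beta\mu)\bigg].$$
   Context: $\mathrm{AL}(\alpha,\beta,\mu)$ denotes the asymmetric Laplace distribution, with probability density function $p(x)=\frac{\alpha^2-\beta^2}{2\alpha}\,\mathrm{e}^{\beta(x-\mu)-\alpha|x-\mu|}$, $x\in\mathbb{R}$. $M(a,b,x)={}_1F_1(a;b;x)$ and $U(a,b,x)$ are the confluent hypergeometric functions of the first and second kind (Kummer and Tricomi functions), and $\mathrm{sgn}$ is the sign function. *)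

theory Defs
  imports "HOL-Probability.Probability"
begin

definition asymmetric_laplace_density :: "real \<Rightarrow> real \<Rightarrow> real \<Rightarrow> real \<Rightarrow> real" where
  "asymmetric_laplace_density \<alpha> \<beta> \<mu> x =
     (\<alpha>\<^sup>2 - \<beta>\<^sup>2) / (2 * \<alpha>) * exp (\<beta> * (x - \<mu>) - \<alpha> * \<bar>x - \<mu>\<bar>)"

text \<open>Kummer's function \<open>1F1(a; b; x)\<close>; meaningful only if \<open>b\<close> is not a non-positive integer.\<close>

definition kummer_M :: "real \<Rightarrow> real \<Rightarrow> real \<Rightarrow> real" where
  "kummer_M a b x = (\<Sum>n. pochhammer a n / pochhammer b n * x ^ n / fact n)"

text \<open>
  Tricomi's function for \<open>x > 0\<close>. For non-integer \<open>b\<close> it is the usual combination of the two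
  Kummer solutions; for integer \<open>b\<close>, where the individual terms can have poles that cancel,
  it is the extension by continuity in the second parameter. The reciprocal Gamma function
  takes care of the poles of \<open>Gamma\<close> in the denominators.
\<close>

definition tricomi_U_generic :: "real \<Rightarrow> real \<Rightarrow> real \<Rightarrow> real" where
  "tricomi_U_generic a b x =
     Gamma (1 - b) * rGamma (a - b + 1) * kummer_M a b x +
     Gamma (b - 1) * rGamma a * x powr (1 - b) * kummer_M (a - b + 1) (2 - b) x"

definition tricomi_U :: "real \<Rightarrow> real \<Rightarrow> real \<Rightarrow> real" where
  "tricomi_U a b x =
     (if b \<in> \<int> then Lim (at b) (\<lambda>c. tricomi_U_generic a c x) else tricomi_U_generic a b x)"

end

theory Submission
  imports Defs
begin

text \<open>
  Substituting \<open>x = \<mu> s\<close> reduces both signs of \<open>\<mu>\<close> to the integral of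
  \<open>\<bar>s\<bar>\<^sup>r exp (B (s - 1) - A \<bar>s - 1\<bar>)\<close> with \<open>A = \<alpha> \<bar>\<mu>\<bar>\<close> and \<open>B = \<beta> \<mu>\<close>, which is split at
  \<open>s = 0\<close> and \<open>s = 1\<close>. The part on \<open>s < 0\<close> is a Gamma integral. The part on \<open>[0, 1]\<close> is a
  Kummer function: integrating \<open>s\<^sup>b\<^sup>-\<^sup>2 exp (z (1 - s))\<close> by parts repeatedly produces the series of
  \<open>M(1, b, z) / (b - 1)\<close>. The part on \<open>s > 1\<close> is a Gamma integral minus an integral over
  \<open>[0, 1]\<close>, which is the formula defining \<open>U(1, b, z)\<close> for non-integer \<open>b\<close>; its right-hand side
  \<open>\<Gamma>(b - 1) z\<^sup>1\<^sup>-\<^sup>b exp z - M(1, b, z) / (b - 1)\<close> is continuous in \<open>b > 1\<close>, hence integer \<open>b\<close> need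
  no separate treatment.
\<close>

section \<open>The series of M(1, b, z) as a function of b\<close>

lemma pochhammer_ge_fact:
  assumes "b \<ge> (1::real)"
  shows "pochhammer b n \<ge> fact n"
proof (induction n)
  case (Suc n)
  have "fact (Suc n) = fact n * (1 + real n)"
    by simp
  also have "\<dots> \<le> pochhammer b n * (b + real n)"
    using Suc assms by (intro mult_mono pochhammer_nonneg) auto
  finally show ?case
    by (simp add: pochhammer_Suc)
qed simp

text \<open>The majorant does not depend on \<open>b\<close>: it feeds the Weierstrass test for
  continuity in \<open>b\<close> and also controls the remainder of the repeated integration by
  parts.\<close>

lemma abs_power_over_pochhammer_le:
  assumes "b \<ge> (1::real)"
  shows "\<bar>z ^ n / pochhammer b n\<bar> \<le> \<bar>z\<bar> ^ n / fact n"
proof -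
  have "fact n \<le> pochhammer b n" "(0::real) < fact n"
    using pochhammer_ge_fact[OF assms] by auto
  then show ?thesis
    by (simp add: abs_mult power_abs frac_le)
qed

lemma summable_abs_power_over_fact: "summable (\<lambda>n. \<bar>z :: real\<bar> ^ n / fact n)"
  using summable_exp[of "\<bar>z\<bar>"] by (simp add: field_simps)

lemma kummer_M_1: "kummer_M 1 b z = (\<Sum>n. z ^ n / pochhammer b n)"
  by (simp add: kummer_M_def pochhammer_fact[symmetric])

lemma summable_power_over_pochhammer:
  assumes "b \<ge> (1::real)"
  shows "summable (\<lambda>n. z ^ n / pochhammer b n)"
  by (rule summable_comparison_test'[OF summable_abs_power_over_fact[of z], of 0])
     (use abs_power_over_pochhammer_le[OF assms] in auto)

lemma isCont_kummer_M_1: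
  assumes "b > 1"
  shows "isCont (\<lambda>b. kummer_M 1 b z) b"
proof -
  have "uniform_limit {1<..} (\<lambda>n b. \<Sum>i<n. z ^ i / pochhammer b i)
          (\<lambda>b. \<Sum>i. z ^ i / pochhammer b i) sequentially"
    by (rule Weierstrass_m_test[OF _ summable_abs_power_over_fact[of z]])
       (use abs_power_over_pochhammer_le in force)
  moreover have "continuous_on {1<..} (\<lambda>b. \<Sum>i<n. z ^ i / pochhammer b i)" for n
  proof -
    have "pochhammer b i \<noteq> 0" if "b > 1" for b :: real and i
      using pochhammer_pos[of b i] that by simp
    then show ?thesis
      by (auto simp: pochhammer_prod intro!: continuous_intros)
  qed
  ultimately have "continuous_on {1<..} (\<lambda>b. \<Sum>i. z ^ i / pochhammer b i)"
    by (intro uniform_limit_theorem[where F = sequentially]) auto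
  then show ?thesis
    using assms by (simp add: kummer_M_1 continuous_on_eq_continuous_at)
qed

section \<open>The integral representation of M(1, b, z)\<close>

lemma
  assumes "b > (1::real)"
  shows powr_exp_integrable_on_01:
      "(\<lambda>s. s powr (b - 2) * exp (z * (1 - s))) integrable_on {0..1}" (is ?int)
    and integral_powr_exp_01_rec:
      "(b - 1) * integral {0..1} (\<lambda>s. s powr (b - 2) * exp (z * (1 - s))) =
         1 + z * integral {0..1} (\<lambda>s. s powr (b - 1) * exp (z * (1 - s)))" (is ?eq)
proof -
  let ?f = "\<lambda>s. s powr (b - 2) * exp (z * (1 - s))"
  let ?g = "\<lambda>s. s powr (b - 1) * exp (z * (1 - s))"
  have cont: "continuous_on {0..1} ?g"
    using assms by (intro continuous_on_mult continuous_on_powr' continuous_intros) auto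
  then have g: "(?g has_integral integral {0..1} ?g) {0..1}"
    by (simp add: integrable_continuous_interval integrable_integral)
  \<comment> \<open>For \<open>b < 2\<close> the function \<open>?f\<close> is unbounded near 0,
    whereas \<open>?g\<close> is continuous on the closed interval. Differentiating
    \<open>?g\<close> only in the interior therefore yields the integrability of \<open>?f\<close>
    together with the recurrence; the boundary values are \<open>?g 1 = 1\<close> and
    \<open>?g 0 = 0\<close>.\<close>
  have "((\<lambda>s. (b - 1) * ?f s - z * ?g s) has_integral (?g 1 - ?g 0)) {0..1}"
  proof (rule fundamental_theorem_of_calculus_interior[OF _ cont])
    fix x :: real
    assume "x \<in> {0<..<1}"
    then show "(?g has_vector_derivative (b - 1) * ?f x - z * ?g x) (at x)"
      unfolding has_real_derivative_iff_has_vector_derivative[symmetric]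
      by (auto intro!: derivative_eq_intros simp: algebra_simps)
  qed simp
  from has_integral_add[OF this has_integral_mult_right[OF g, of z]]
  have "((\<lambda>s. (b - 1) * ?f s) has_integral (1 + z * integral {0..1} ?g)) {0..1}"
    using assms by simp
  from has_integral_divide[OF this, of "b - 1"]
  have f: "(?f has_integral (1 + z * integral {0..1} ?g) / (b - 1)) {0..1}"
    using assms by simp
  show ?int
    using f by blast
  show ?eq
    using integral_unique[OF f] assms by simp
qed

lemma has_integral_kummer_M_1:
  assumes "b > (1::real)"
  shows "((\<lambda>s. s powr (b - 2) * exp (z * (1 - s))) has_integral kummer_M 1 b z / (b - 1)) {0..1}"
proof -
  define J where "J b = integral {0..1} (\<lambda>s. s powr (b - 2) * exp (z * (1 - s)))" for b
  have rec: "(b - 1) * J b = 1 + z * J (b + 1)" if "b > 1" for b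
    using integral_powr_exp_01_rec[OF that] by (simp add: J_def add_diff_eq)
  \<comment> \<open>The remainder keeps the factor \<open>b + n - 1\<close> so that
    \<open>rec\<close> at \<open>b + n\<close> applies to it directly and splits off exactly one
    term of the series.\<close>
  have expand: "(b - 1) * J b = (\<Sum>k<n. z ^ k / pochhammer b k)
      + z ^ n / pochhammer b n * ((b + n - 1) * J (b + n))" for n
  proof (induction n)
    case (Suc n)
    have "pochhammer b n \<noteq> 0" "b + n \<noteq> 0"
      using pochhammer_pos[of b n] assms by auto
    then have "z ^ Suc n / pochhammer b (Suc n) * ((b + Suc n - 1) * J (b + Suc n)) =
        z ^ n / pochhammer b n * (z * J (b + n + 1))"
      by (simp add: pochhammer_Suc add_ac)
    then show ?case
      using Suc rec[of "b + n"] assms by (simp add: distrib_left)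
  qed simp
  have J_bound: "\<bar>J c\<bar> \<le> exp \<bar>z\<bar>" if "c > 2" for c
  proof -
    have "norm (J c) \<le> exp \<bar>z\<bar> * (1 - 0)"
      unfolding J_def
    proof (rule integral_bound)
      show "continuous_on {0..1} (\<lambda>s. s powr (c - 2) * exp (z * (1 - s)))"
        using that by (intro continuous_on_mult continuous_on_powr' continuous_intros) auto
      fix t :: real
      assume t: "t \<in> {0..1}"
      have "t powr (c - 2) \<le> 1"
        using t that by (intro powr_le1) auto
      moreover have "z * (1 - t) \<le> \<bar>z\<bar> * 1"
        using t by (intro mult_mono) auto
      ultimately have "t powr (c - 2) * exp (z * (1 - t)) \<le> 1 * exp \<bar>z\<bar>"
        by (intro mult_mono) auto
      then show "norm (t powr (c - 2) * exp (z * (1 - t))) \<le> exp \<bar>z\<bar>"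
        by simp
    qed simp
    then show ?thesis
      by simp
  qed
  have "(\<lambda>n. z ^ n / pochhammer b n * ((b + n - 1) * J (b + n))) \<longlonglongrightarrow> 0"
  proof (rule Lim_null_comparison)
    show "\<forall>\<^sub>F n in sequentially. norm (z ^ n / pochhammer b n * ((b + n - 1) * J (b + n)))
            \<le> \<bar>z\<bar> ^ n / fact n * (1 + \<bar>z\<bar> * exp \<bar>z\<bar>)"
    proof (rule always_eventually, rule allI)
      fix n :: nat
      \<comment> \<open>The factor \<open>b + n - 1\<close> grows with \<open>n\<close>; one more
        use of \<open>rec\<close> absorbs it and moves the argument of \<open>J\<close> to
        \<open>b + n + 1 > 2\<close>, where \<open>J_bound\<close> is available for every
        \<open>n\<close>.\<close>
      have "\<bar>(b + n - 1) * J (b + n)\<bar> \<le> 1 + \<bar>z * J (b + n + 1)\<bar>"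
        using rec[of "b + n"] assms by simp
      also have "\<dots> \<le> 1 + \<bar>z\<bar> * exp \<bar>z\<bar>"
        using J_bound[of "b + n + 1"] assms by (simp add: abs_mult mult_left_mono)
      finally show "norm (z ^ n / pochhammer b n * ((b + n - 1) * J (b + n)))
                      \<le> \<bar>z\<bar> ^ n / fact n * (1 + \<bar>z\<bar> * exp \<bar>z\<bar>)"
        using abs_power_over_pochhammer_le[of b z n] assms
        unfolding real_norm_def abs_mult by (intro mult_mono) auto
    qed
    show "(\<lambda>n. \<bar>z\<bar> ^ n / fact n * (1 + \<bar>z\<bar> * exp \<bar>z\<bar>)) \<longlonglongrightarrow> 0"
      by (intro tendsto_mult_left_zero summable_LIMSEQ_zero summable_abs_power_over_fact)
  qed
  moreover have "(\<lambda>n. \<Sum>k<n. z ^ k / pochhammer b k) \<longlonglongrightarrow> kummer_M 1 b z"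
    unfolding kummer_M_1 using assms
    by (intro summable_LIMSEQ summable_power_over_pochhammer) simp
  ultimately have "(\<lambda>n. (\<Sum>k<n. z ^ k / pochhammer b k)
      + z ^ n / pochhammer b n * ((b + n - 1) * J (b + n))) \<longlonglongrightarrow> kummer_M 1 b z + 0"
    by (intro tendsto_add)
  \<comment> \<open>By \<open>expand\<close> the sequence is constant, so its limit is its
    value.\<close>
  then have "(\<lambda>n :: nat. (b - 1) * J b) \<longlonglongrightarrow> kummer_M 1 b z + 0"
    by (simp only: expand[symmetric])
  then have "(b - 1) * J b = kummer_M 1 b z"
    by (simp add: LIMSEQ_const_iff)
  then have "J b = kummer_M 1 b z / (b - 1)"
    using assms by (simp add: field_simps)
  then show ?thesis
    using integrable_integral[OF powr_exp_integrable_on_01[OF assms, of z]] by (simp add: J_def)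
qed

section \<open>Tricomi's function U(1, b, z) in closed form\<close>

lemma tricomi_U_generic_1:
  assumes "b \<notin> \<int>" and "z > 0"
  shows "tricomi_U_generic 1 b z =
           Gamma (b - 1) * z powr (1 - b) * exp z - kummer_M 1 b z / (b - 1)"
proof -
  have b: "1 - b \<notin> \<int>"
    using assms Ints_diff[of 1 "1 - b"] by auto
  have "2 - b \<notin> \<int>"
    using assms Ints_diff[of 2 "2 - b"] by auto
  \<comment> \<open>For \<open>a = 1\<close> the second Kummer function has equal parameters
    \<open>2 - b\<close>. As no Pochhammer symbol vanishes, the quotients cancel and the exponential
    series remains.\<close>
  then have "pochhammer (2 - b) n \<noteq> 0" for n
    using Ints_minus[OF Ints_of_nat] by (metis pochhammer_eq_0_iff)
  then have "kummer_M (2 - b) (2 - b) z = exp z"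
    by (simp add: kummer_M_def exp_def divide_inverse mult.commute)
  moreover have "Gamma (1 - b) * rGamma (2 - b) = - 1 / (b - 1)"
  proof -
    have "1 - b \<notin> \<int>\<^sub>\<le>\<^sub>0"
      using b nonpos_Ints_Int by blast
    then have "Gamma (1 - b) \<noteq> 0" "Gamma (2 - b) = (1 - b) * Gamma (1 - b)"
      using Gamma_plus1[of "1 - b"] by (auto simp: Gamma_eq_zero_iff)
    moreover have "b \<noteq> 1"
      using assms by auto
    ultimately show ?thesis
      by (simp add: rGamma_inverse_Gamma divide_simps)
  qed
  ultimately show ?thesis
    by (simp add: tricomi_U_generic_def mult_ac)
qed

lemma tricomi_U_1:
  assumes "b > 1" and "z > 0"
  shows "tricomi_U 1 b z =
           Gamma (b - 1) * z powr (1 - b) * exp z - kummer_M 1 b z / (b - 1)"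
proof (cases "b \<in> \<int>")
  case False
  then show ?thesis
    using assms by (simp add: tricomi_U_def tricomi_U_generic_1)
next
  case True
  let ?V = "\<lambda>b. Gamma (b - 1) * z powr (1 - b) * exp z - kummer_M 1 b z / (b - 1)"
  have "b - 1 \<notin> \<int>\<^sub>\<le>\<^sub>0"
    using assms by (auto elim!: nonpos_Ints_cases)
  then have "isCont ?V b"
    using assms by (intro continuous_intros isCont_kummer_M_1) auto
  then have "?V \<midarrow>b\<rightarrow> ?V b"
    by (simp add: isCont_def)
  moreover have "\<forall>\<^sub>F c in at b. ?V c = tricomi_U_generic 1 c z"
  proof -
    \<comment> \<open>Integers are isolated, so the non-integer formula holds on a punctured
      neighbourhood of the integer \<open>b\<close>, which is all that the limit defining
      \<open>tricomi_U\<close> sees.\<close>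
    have "\<forall>\<^sub>F c in at b. c \<notin> \<int>"
      unfolding eventually_at
    proof (intro exI[of _ 1] conjI ballI impI)
      fix c
      assume "c \<noteq> b \<and> dist c b < 1"
      then have "c - b \<notin> \<int>"
        using Ints_nonzero_abs_less1[of "c - b"] by (auto simp: dist_real_def)
      then show "c \<notin> \<int>"
        using True by auto
    qed simp
    then show ?thesis
      by eventually_elim (use assms in \<open>simp add: tricomi_U_generic_1\<close>)
  qed
  ultimately have "(\<lambda>c. tricomi_U_generic 1 c z) \<midarrow>b\<rightarrow> ?V b"
    by (rule Lim_transform_eventually)
  then show ?thesis
    using True by (simp add: tricomi_U_def tendsto_Lim)
qed

section \<open>Lebesgue integrals over the three pieces of the line\<close>

lemma has_bochner_integral_has_integral_nonneg:
  fixes f :: "real \<Rightarrow> real"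
  assumes [measurable]: "f \<in> borel_measurable borel" "S \<in> sets borel"
    and nonneg: "\<And>x. x \<in> S \<Longrightarrow> 0 \<le> f x" and I: "(f has_integral I) S"
  shows "has_bochner_integral lborel (\<lambda>x. indicator S x * f x) I"
proof (rule has_bochner_integral_nn_integral)
  show "0 \<le> I"
    using has_integral_nonneg[OF I nonneg] by simp
  \<comment> \<open>For a nonnegative integrand the gauge integral determines the Lebesgue integral,
    so absolute integrability comes with the value.\<close>
  show "(\<integral>\<^sup>+x. ennreal (indicator S x * f x) \<partial>lborel) = ennreal I"
    by (rule nn_integral_has_integral_lebesgue[OF nonneg I])
qed (auto simp: nonneg indicator_def)

lemma has_bochner_integral_powr_exp_Ici:
  fixes r c :: real
  assumes "r > -1" and "c > 0"
  shows "has_bochner_integral lborel (\<lambda>x. indicator {0..} x * (x powr r * exp (- c * x)))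
           (Gamma (r + 1) / c powr (r + 1))"
proof -
  have "((\<lambda>t. t powr r / exp t) has_integral Gamma (r + 1)) {0..}"
    using Gamma_integral_real[of "r + 1"] assms by simp
  then have "has_bochner_integral lborel (\<lambda>x. indicator {0..} x * (x powr r / exp x)) (Gamma (r + 1))"
    by (intro has_bochner_integral_has_integral_nonneg) auto
  then have "has_bochner_integral lborel
      (\<lambda>x. indicator {0..} (0 + c * x) * ((0 + c * x) powr r / exp (0 + c * x))) (Gamma (r + 1) /\<^sub>R \<bar>c\<bar>)"
    using assms by (subst (asm) lborel_has_bochner_integral_real_affine_iff[where c = c and t = 0]) auto
  \<comment> \<open>This constant cancels the factor \<open>c powr r\<close> that the substitution
    produces inside the power.\<close>
  from has_bochner_integral_mult_right[OF this, of "c powr (- r)"]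
  have "has_bochner_integral lborel
      (\<lambda>x. c powr (- r) * (indicator {0..} (c * x) * ((c * x) powr r / exp (c * x))))
      (c powr (- r) * (Gamma (r + 1) / c))"
    using assms by (simp add: divide_inverse mult_ac)
  moreover have "c powr (- r) * (indicator {0..} (c * x) * ((c * x) powr r / exp (c * x))) =
      indicator {0..} x * (x powr r * exp (- c * x))" for x
    using assms by (auto simp: indicator_def powr_mult powr_minus exp_minus field_simps zero_le_mult_iff)
  moreover have "c powr (- r) * (Gamma (r + 1) / c) = Gamma (r + 1) / c powr (r + 1)"
    using assms by (simp add: powr_add powr_minus field_simps)
  ultimately show ?thesis
    by simp
qed

lemma has_bochner_integral_powr_exp_01:
  fixes r z :: real
  assumes "r > -1"
  shows "has_bochner_integral lborel (\<lambda>x. indicator {0..1} x * (x powr r * exp (z * (1 - x))))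
           (kummer_M 1 (r + 2) z / (r + 1))"
  using has_integral_kummer_M_1[of "r + 2" z] assms
  by (intro has_bochner_integral_has_integral_nonneg) (auto simp: add.commute)

lemma has_bochner_integral_tricomi_U_1:
  assumes "r > -1" and "z > 0"
  shows "has_bochner_integral lborel (\<lambda>x. indicator {1<..} x * (x powr r * exp (- z * (x - 1))))
           (tricomi_U 1 (r + 2) z)"
proof -
  \<comment> \<open>The factor \<open>exp z\<close> turns \<open>exp (- z * x)\<close> into
    \<open>exp (z * (1 - x))\<close>, so the contributions on [0, 1] cancel and only x > 1
    survives.\<close>
  have "has_bochner_integral lborel
     (\<lambda>x. exp z * (indicator {0..} x * (x powr r * exp (- z * x))) -
          indicator {0..1} x * (x powr r * exp (z * (1 - x))))
     (exp z * (Gamma (r + 1) / z powr (r + 1)) - kummer_M 1 (r + 2) z / (r + 1))"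
    using assms by (intro has_bochner_integral_diff has_bochner_integral_mult_right
        has_bochner_integral_powr_exp_Ici has_bochner_integral_powr_exp_01)
  moreover have "exp z * (indicator {0..} x * (x powr r * exp (- z * x))) -
          indicator {0..1} x * (x powr r * exp (z * (1 - x))) =
        indicator {1<..} x * (x powr r * exp (- z * (x - 1)))" for x
    by (auto simp: indicator_def algebra_simps exp_add[symmetric] exp_diff exp_minus divide_inverse)
  moreover have "exp z * (Gamma (r + 1) / z powr (r + 1)) - kummer_M 1 (r + 2) z / (r + 1) =
      tricomi_U 1 (r + 2) z"
  proof -
    have "z powr (1 - (r + 2)) = inverse (z powr (r + 1))"
      by (simp add: powr_minus[symmetric] algebra_simps)
    then show ?thesis
      using assms by (simp add: tricomi_U_1 divide_inverse mult_ac add.commute)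
  qed
  ultimately show ?thesis
    by simp
qed

text \<open>The exponent is \<open>(A + B) * (s - 1)\<close> for s at most 1 and
  \<open>- (A - B) * (s - 1)\<close> beyond; \<open>\<bar>B\<bar> < A\<close> makes both rates
  positive. The half-line s < 0 is reflected to a Gamma integral with rate
  \<open>A + B\<close>.\<close>

lemma has_bochner_integral_abs_powr_two_sided_exp:
  assumes "\<bar>B\<bar> < A" and "r > -1"
  shows "has_bochner_integral lborel (\<lambda>s. \<bar>s\<bar> powr r * exp (B * (s - 1) - A * \<bar>s - 1\<bar>))
    (exp (- A - B) * (Gamma (r + 1) / (A + B) powr (r + 1))
      + kummer_M 1 (r + 2) (- A - B) / (r + 1) + tricomi_U 1 (r + 2) (A - B))"
    (is "has_bochner_integral _ ?f (?G + ?M + ?U)")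
proof -
  have "has_bochner_integral lborel (\<lambda>x. indicator {0..} (0 + (-1) * x) *
          ((0 + (-1) * x) powr r * exp (- (A + B) * (0 + (-1) * x))))
        ((Gamma (r + 1) / (A + B) powr (r + 1)) /\<^sub>R \<bar>-1\<bar>)"
    using assms
    by (intro lborel_has_bochner_integral_real_affine_iff[THEN iffD1] has_bochner_integral_powr_exp_Ici) auto
  then have "has_bochner_integral lborel (\<lambda>x. indicator {0..} (- x) * ((- x) powr r * exp ((A + B) * x)))
          (Gamma (r + 1) / (A + B) powr (r + 1))"
    by (simp add: algebra_simps)
  then have "has_bochner_integral lborel
      (\<lambda>x. exp (- A - B) * (indicator {0..} (- x) * ((- x) powr r * exp ((A + B) * x)))
          + indicator {0..1} x * (x powr r * exp ((- A - B) * (1 - x)))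
          + indicator {1<..} x * (x powr r * exp (- (A - B) * (x - 1)))) (?G + ?M + ?U)"
    using assms by (intro has_bochner_integral_add has_bochner_integral_mult_right
        has_bochner_integral_powr_exp_01 has_bochner_integral_tricomi_U_1) auto
  moreover have "exp (- A - B) * (indicator {0..} (- x) * ((- x) powr r * exp ((A + B) * x)))
          + indicator {0..1} x * (x powr r * exp ((- A - B) * (1 - x)))
          + indicator {1<..} x * (x powr r * exp (- (A - B) * (x - 1))) = ?f x" for x
  proof -
    \<comment> \<open>At \<open>x = 0\<close> the first two indicators are both 1, but
      \<open>0 powr r = 0\<close> for every \<open>r\<close>, so nothing is counted twice.\<close>
    consider "x < 0" | "x = 0" | "0 < x" "x \<le> 1" | "x > 1"
      by linarith
    then show ?thesis
      by cases (auto simp: indicator_def algebra_simps exp_add exp_diff exp_minus divide_inverse)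
  qed
  ultimately show ?thesis
    by simp
qed

text \<open>Integrability is asserted separately because the Bochner integral of a non-integrable
  function is 0 by default. The convention \<open>0 powr 0 = 0\<close> is harmless for
  \<open>r = 0\<close>, as X has a density and vanishes with probability 0.\<close>

theorem mainTheorem7:
  fixes M :: "'a measure" and X :: "'a \<Rightarrow> real" and \<alpha> \<beta> \<mu> r :: real
  assumes "prob_space M"
    and "0 \<le> \<bar>\<beta>\<bar>" and "\<bar>\<beta>\<bar> < \<alpha>" and "\<mu> \<noteq> 0"
    and "distributed M lborel X (\<lambda>x. ennreal (asymmetric_laplace_density \<alpha> \<beta> \<mu> x))"
    and "r > -1"
  shows "integrable M (\<lambda>\<omega>. \<bar>X \<omega>\<bar> powr r) \<and>
    prob_space.expectation M (\<lambda>\<omega>. \<bar>X \<omega>\<bar> powr r) =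
      (\<alpha>\<^sup>2 - \<beta>\<^sup>2) / (2 * \<alpha> powr (r + 2)) *
        (exp (- \<alpha> * \<bar>\<mu>\<bar> - \<beta> * \<mu>) * Gamma (r + 1) / (1 + sgn \<mu> * \<beta> / \<alpha>) powr (r + 1)
         + (\<alpha> * \<bar>\<mu>\<bar>) powr (r + 1) / (r + 1) * kummer_M 1 (r + 2) (- \<alpha> * \<bar>\<mu>\<bar> - \<beta> * \<mu>)
         + (\<alpha> * \<bar>\<mu>\<bar>) powr (r + 1) * tricomi_U 1 (r + 2) (\<alpha> * \<bar>\<mu>\<bar> - \<beta> * \<mu>))"
    (is "?int \<and> ?E = ?R")
proof -
  define A B where "A = \<alpha> * \<bar>\<mu>\<bar>" and "B = \<beta> * \<mu>"
  define p where "p = asymmetric_laplace_density \<alpha> \<beta> \<mu>"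
  define V where "V = exp (- A - B) * (Gamma (r + 1) / (A + B) powr (r + 1))
      + kummer_M 1 (r + 2) (- A - B) / (r + 1) + tricomi_U 1 (r + 2) (A - B)"
  have pos: "\<alpha> > 0" "A > 0" "\<bar>\<mu>\<bar> > 0"
    using assms by (auto simp: A_def)
  have AB: "\<bar>B\<bar> < A"
    using assms pos by (simp add: A_def B_def abs_mult)
  have "\<beta>\<^sup>2 \<le> \<alpha>\<^sup>2"
    using assms abs_le_square_iff[of \<beta> \<alpha>] by simp
  then have p_nonneg: "p x \<ge> 0" for x
    using pos by (simp add: p_def asymmetric_laplace_density_def)
  have scaled: "p (\<mu> * s) * \<bar>\<mu> * s\<bar> powr r =
      (\<alpha>\<^sup>2 - \<beta>\<^sup>2) / (2 * \<alpha>) * \<bar>\<mu>\<bar> powr r * (\<bar>s\<bar> powr r * exp (B * (s - 1) - A * \<bar>s - 1\<bar>))" for s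
  proof -
    have "\<mu> * s - \<mu> = \<mu> * (s - 1)"
      by (simp add: algebra_simps)
    then show ?thesis
      by (simp add: p_def asymmetric_laplace_density_def A_def B_def abs_mult powr_mult mult_ac)
  qed
  have "has_bochner_integral lborel (\<lambda>s. p (0 + \<mu> * s) * \<bar>0 + \<mu> * s\<bar> powr r)
          ((\<alpha>\<^sup>2 - \<beta>\<^sup>2) / (2 * \<alpha>) * \<bar>\<mu>\<bar> powr r * V)"
    unfolding add_0 scaled V_def using assms AB
    by (intro has_bochner_integral_mult_right has_bochner_integral_abs_powr_two_sided_exp)
  \<comment> \<open>The Jacobian of x = \<mu> s is \<open>\<bar>\<mu>\<bar>\<close> for either sign
    of \<mu>, which raises the exponent of \<open>\<bar>\<mu>\<bar>\<close> to
    \<open>r + 1\<close>.\<close>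
  then have int: "has_bochner_integral lborel (\<lambda>x. p x * \<bar>x\<bar> powr r)
          (\<bar>\<mu>\<bar> * ((\<alpha>\<^sup>2 - \<beta>\<^sup>2) / (2 * \<alpha>) * \<bar>\<mu>\<bar> powr r * V))"
    using pos by (subst lborel_has_bochner_integral_real_affine_iff[where c = \<mu> and t = 0])
      (simp_all flip: mult.assoc)
  have D: "distributed M lborel X (\<lambda>x. ennreal (p x))"
    using assms by (simp add: p_def)
  have ?int
    using distributed_integrable[OF D, of "\<lambda>x. \<bar>x\<bar> powr r"] int p_nonneg
    by (simp add: has_bochner_integral_iff)
  have "?E = (\<integral>x. p x * \<bar>x\<bar> powr r \<partial>lborel)"
    using distributed_integral[OF D, of "\<lambda>x. \<bar>x\<bar> powr r"] p_nonneg by simp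
  also have "\<dots> = (\<alpha>\<^sup>2 - \<beta>\<^sup>2) / (2 * \<alpha>) * \<bar>\<mu>\<bar> powr (r + 1) * V"
    using has_bochner_integral_integral_eq[OF int] pos by (simp add: powr_add mult_ac)
  also have "\<dots> = (\<alpha>\<^sup>2 - \<beta>\<^sup>2) / (2 * \<alpha> powr (r + 2)) * (A powr (r + 1) * V)"
  proof -
    \<comment> \<open>Completing \<open>\<bar>\<mu>\<bar> powr (r + 1)\<close> to
      \<open>A powr (r + 1)\<close> costs \<open>\<alpha> powr (r + 1)\<close>; with the \<alpha>
      already in the denominator this gives the exponent \<open>r + 2\<close>.\<close>
    have "\<alpha> powr (r + 2) = \<alpha> powr (r + 1) * \<alpha>"
      using pos by (simp add: powr_add power2_eq_square)
    then show ?thesis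
      using pos by (simp add: A_def powr_mult)
  qed
  also have "A powr (r + 1) * V =
      exp (- A - B) * Gamma (r + 1) / (1 + sgn \<mu> * \<beta> / \<alpha>) powr (r + 1)
      + A powr (r + 1) / (r + 1) * kummer_M 1 (r + 2) (- A - B)
      + A powr (r + 1) * tricomi_U 1 (r + 2) (A - B)"
  proof -
    \<comment> \<open>Since \<mu> equals \<open>sgn \<mu> * \<bar>\<mu>\<bar>\<close>,
      \<open>A\<close> factors out of \<open>A + B\<close>. Its power then cancels in the Gamma term
      and stays in the other two.\<close>
    have "A + B = A * (1 + sgn \<mu> * \<beta> / \<alpha>)"
      using pos assms(4) by (auto simp: A_def B_def sgn_if field_simps)
    moreover from this have "1 + sgn \<mu> * \<beta> / \<alpha> > 0"
      using AB pos by (smt (verit) zero_less_mult_pos)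
    ultimately have "(A + B) powr (r + 1) = A powr (r + 1) * (1 + sgn \<mu> * \<beta> / \<alpha>) powr (r + 1)"
      using pos by (simp add: powr_mult)
    then show ?thesis
      using pos by (simp add: V_def distrib_left)
  qed
  finally show ?thesis
    using \<open>?int\<close> by (simp add: A_def B_def)
qed

end
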